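(* Let $\lambda>0$ and let $\Delta_1,\Delta_2,\ldots$ be IID Laplace$(\lambda)$ random variables, i.e. with density $f_\Delta(\delta)=\frac{\lambda}{2}e^{-\lambda|\delta|}$. Under the policy $\pi^{(1)}$ described in the context, the stationary distribution of the stored-power Markov process $(S_i)$ has cdf $$F_S(s)=\frac{1-\frac{1+\alpha}{2}e^{-(1/\alpha_c-\alpha_d)\lambda s/2}}{1-\alpha e^{-(1/\alpha_c-\alpha_d)\lambda S_{\max}/2}}\qquad\text{for }0\le s<S_{\max},$$ $F_S(s)=0$ for $s<0$, and $F_S(s)=1$ for $s\ge S_{\max}$. The corresponding distribution of the fast-ramping generation (the law of $G_i$ under $\pi^{(1)}$ when $S_i$ has cdf $F_S$) has cdf $$F_G(g)=1-\frac{1-\alpha}{2\left(1-\alpha e^{-(1/\alpha_c-\alpha_d)\lambda S_{\max}/2}\right)}e^{-\lambda g}\qquad\text{for }0\le g<G_{\max},$$ $F_G(g)=0$ for $g<0$, and $F_G(g)=1$ for $g\ge G_{\max}$.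
   Context: Constants: charging efficiency $\alpha_c\in(0,1)$, discharging efficiency $\alpha_d\in(0,1)$, round-trip efficiency $\alpha=\alpha_c\alpha_d$, fast-ramping generation capacity $G_{\max}\ge 0$, power storage capacity $S_{\max}\ge 0$. The stored power evolves as $S_{i+1}=S_i+\alpha_cC_i-\frac{1}{\alpha_d}D_i$ with $S_1\in[0,S_{\max}]$, where $G_i,C_i,D_i$ are the fast-ramping generation, charging and discharging powers in slot $i$. The policy $\pi^{(1)}$: - if $\frac{S_{\max}-S_i}{\alpha_c}\le\Delta_i$: $(G_i,C_i,D_i)=(0,\frac{S_{\max}-S_i}{\alpha_c},0)$, so $S_{i+1}=S_{\max}$; - if $0\le\Delta_i<\frac{S_{\max}-S_i}{\alpha_c}$: $(0,\Delta_i,0)$, so $S_{i+1}=S_i+\alpha_c\Delta_i$; - if $-\alpha_dS_i\le\Delta_i<0$: $(0,0,-\Delta_i)$, so $S_{i+1}=S_i+\Delta_i/\alpha_d$; - if $-G_{\max}-\alpha_dS_i\le\Delta_i<-\alpha_dS_i$: $(-\Delta_i-\alpha_dS_i,0,\alpha_dS_i)$, so $S_{i+1}=0$; - if $\Delta_i<-G_{\max}-\alpha_dS_i$: $(G_{\max},0,\alpha_dS_i)$, so $S_{i+1}=0$. Since the $\Delta_i$ are IID, $(S_i)$ is a homogeneous Markov process on $[0,S_{\max}]$, and $\Delta_i$ is independent of $S_i$. *)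

theory Defs
  imports "HOL-Probability.Probability"
begin

definition laplace_density :: "real \<Rightarrow> real \<Rightarrow> real" where
  "laplace_density l x = l / 2 * exp (- l * \<bar>x\<bar>)"

definition laplace_measure :: "real \<Rightarrow> real measure" where
  "laplace_measure l = density lborel (\<lambda>x. ennreal (laplace_density l x))"

text \<open>
  The policy, as a map from the stored power \<open>s\<close> and the net input \<open>\<delta>\<close> of a slot to the triple
  (fast-ramping generation, charging power, discharging power). Each branch is taken only when the
  conditions of all earlier branches fail, which supplies the upper bounds on \<open>\<delta>\<close>.
\<close>

definition storage_policy ::
    "real \<Rightarrow> real \<Rightarrow> real \<Rightarrow> real \<Rightarrow> real \<Rightarrow> real \<Rightarrow> real \<times> real \<times> real" where
  "storage_policy \<alpha>c \<alpha>d Gmax Smax s \<delta> =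
    (if (Smax - s) / \<alpha>c \<le> \<delta> then (0, (Smax - s) / \<alpha>c, 0)
     else if 0 \<le> \<delta> then (0, \<delta>, 0)
     else if - \<alpha>d * s \<le> \<delta> then (0, 0, - \<delta>)
     else if - Gmax - \<alpha>d * s \<le> \<delta> then (- \<delta> - \<alpha>d * s, 0, \<alpha>d * s)
     else (Gmax, 0, \<alpha>d * s))"

definition next_storage ::
    "real \<Rightarrow> real \<Rightarrow> real \<Rightarrow> real \<Rightarrow> real \<Rightarrow> real \<Rightarrow> real" where
  "next_storage \<alpha>c \<alpha>d Gmax Smax s \<delta> =
    (case storage_policy \<alpha>c \<alpha>d Gmax Smax s \<delta> of (g, c, d) \<Rightarrow> s + \<alpha>c * c - 1 / \<alpha>d * d)"

text \<open>
  One-step transition kernel of the stored power when the net input of the slot has law \<open>\<nu>\<close> and is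
  independent of the stored power.
\<close>

definition storage_kernel ::
    "real \<Rightarrow> real \<Rightarrow> real \<Rightarrow> real \<Rightarrow> real measure \<Rightarrow> real \<Rightarrow> real measure" where
  "storage_kernel \<alpha>c \<alpha>d Gmax Smax \<nu> s = distr \<nu> borel (next_storage \<alpha>c \<alpha>d Gmax Smax s)"

definition stationary_distribution ::
    "(real \<Rightarrow> real measure) \<Rightarrow> real set \<Rightarrow> real measure \<Rightarrow> bool" where
  "stationary_distribution K X \<mu> \<longleftrightarrow>
    real_distribution \<mu> \<and> emeasure \<mu> X = 1 \<and>
    (\<forall>A\<in>sets borel. emeasure \<mu> A = (\<integral>\<^sup>+ s. emeasure (K s) A \<partial>\<mu>))"

definition stored_power_cdf :: "real \<Rightarrow> real \<Rightarrow> real \<Rightarrow> real \<Rightarrow> real \<Rightarrow> real" where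
  "stored_power_cdf \<alpha>c \<alpha>d Smax l s =
    (if s < 0 then 0
     else if s < Smax then
       (1 - (1 + \<alpha>c * \<alpha>d) / 2 * exp (- (1 / \<alpha>c - \<alpha>d) * l * s / 2)) /
       (1 - \<alpha>c * \<alpha>d * exp (- (1 / \<alpha>c - \<alpha>d) * l * Smax / 2))
     else 1)"

definition generation_cdf ::
    "real \<Rightarrow> real \<Rightarrow> real \<Rightarrow> real \<Rightarrow> real \<Rightarrow> real \<Rightarrow> real" where
  "generation_cdf \<alpha>c \<alpha>d Gmax Smax l g =
    (if g < 0 then 0
     else if g < Gmax then
       1 - (1 - \<alpha>c * \<alpha>d) / (2 * (1 - \<alpha>c * \<alpha>d * exp (- (1 / \<alpha>c - \<alpha>d) * l * Smax / 2)))
           * exp (- l * g)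
     else 1)"

lemma measurable_next_storage [measurable]:
  "(\<lambda>(s, \<delta>). next_storage \<alpha>c \<alpha>d Gmax Smax s \<delta>) \<in> borel_measurable (borel \<Otimes>\<^sub>M borel)"
  unfolding next_storage_def storage_policy_def if_distrib[where f = "case_prod _"] prod.case
  by measurable

lemma measurable_storage_kernel:
  assumes "real_distribution \<nu>"
  shows "storage_kernel \<alpha>c \<alpha>d Gmax Smax \<nu> \<in> borel \<rightarrow>\<^sub>M prob_algebra borel"
proof -
  interpret real_distribution \<nu> by fact
  have "\<nu> \<in> space (prob_algebra borel)"
    by (simp add: space_prob_algebra prob_space_axioms)
  then have "(\<lambda>s. distr \<nu> borel (next_storage \<alpha>c \<alpha>d Gmax Smax s)) \<in> borel \<rightarrow>\<^sub>M prob_algebra borel"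
    by (intro measurable_distr_prob_space2[where N = borel and M = borel]) simp_all
  then show ?thesis
    unfolding storage_kernel_def .
qed

end

theory Submission
  imports Defs
begin

text \<open>
  On \<open>[0, Smax]\<close> a step of the storage is the clamping of \<open>s + shift \<delta>\<close> to \<open>[0, Smax]\<close>. Integrating over the
  state first, the cdf of the next state at \<open>x \<in> [0, Smax)\<close> is the average of \<open>F (x - shift \<delta>)\<close> over
  the Laplace input, a sum of integrals of exponentials that evaluates to \<open>F x\<close>. Uniqueness follows from
  Doeblin's condition: with a probability bounded below the storage is emptied, whatever its state.
  The generation exceeds \<open>g < Gmax\<close> iff \<open>\<delta> < - g - \<alpha>d * s\<close>; by the memoryless Laplace tail this has
  probability \<open>exp (- l * g)\<close> times the probability that \<open>\<delta> < - \<alpha>d * s\<close>, which stationarity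
  identifies (for \<open>Smax > 0\<close>) with the mass of the storage law at 0.
\<close>

section \<open>The Laplace law: tails and total mass\<close>

lemma laplace_density_nonneg: "0 < l \<Longrightarrow> 0 \<le> laplace_density l x"
  by (simp add: laplace_density_def)

lemma borel_measurable_laplace_density [measurable]: "laplace_density l \<in> borel_measurable borel"
  unfolding laplace_density_def by measurable

lemma sets_laplace_measure [simp, measurable_cong]: "sets (laplace_measure l) = sets borel"
  by (simp add: laplace_measure_def)

lemma space_laplace_measure [simp]: "space (laplace_measure l) = UNIV"
  by (simp add: laplace_measure_def)

lemma nn_integral_laplace_tail:
  assumes "0 < l" "0 \<le> y"
  shows "(\<integral>\<^sup>+x. ennreal (laplace_density l x) * indicator {y..} x \<partial>lborel) = ennreal (exp (- l * y) / 2)"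
proof -
  have "(\<integral>\<^sup>+x. ennreal (laplace_density l x) * indicator {y..} x \<partial>lborel)
      = (\<integral>\<^sup>+x. ennreal (l / 2 * exp (- l * x)) * indicator {y..} x \<partial>lborel)"
    using assms by (intro nn_integral_cong) (auto simp: laplace_density_def split: split_indicator)
  also have "\<dots> = ennreal (0 - (- exp (- l * y) / 2))"
  proof (rule nn_integral_FTC_atLeast[where F = "\<lambda>x. - exp (- l * x) / 2"])
    show "((\<lambda>x. - exp (- l * x) / 2) \<longlongrightarrow> 0) at_top"
      using assms by real_asymp
  qed (use assms in \<open>auto intro!: derivative_eq_intros\<close>)
  finally show ?thesis by simp
qed

lemma emeasure_laplace_atLeast:
  assumes "0 < l" "0 \<le> y"
  shows "emeasure (laplace_measure l) {y..} = ennreal (exp (- l * y) / 2)"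
  using nn_integral_laplace_tail[OF assms] by (simp add: laplace_measure_def emeasure_density)

text \<open>Reflection at 0 preserves the even density and turns this tail into the right
  one.\<close>

lemma emeasure_laplace_atMost:
  assumes "0 < l" "y \<le> 0"
  shows "emeasure (laplace_measure l) {..y} = ennreal (exp (l * y) / 2)"
proof -
  have "emeasure (laplace_measure l) {..y}
      = (\<integral>\<^sup>+x. ennreal (laplace_density l x) * indicator {..y} x \<partial>lborel)"
    by (simp add: laplace_measure_def emeasure_density)
  also have "\<dots> = (\<integral>\<^sup>+x. ennreal (laplace_density l (- x)) * indicator {..y} (- x) \<partial>lborel)"
    by (subst nn_integral_real_affine[where c = "-1" and t = 0]) auto
  also have "\<dots> = (\<integral>\<^sup>+x. ennreal (laplace_density l x) * indicator {- y..} x \<partial>lborel)"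
    by (intro nn_integral_cong) (auto simp: laplace_density_def split: split_indicator)
  also have "\<dots> = ennreal (exp (l * y) / 2)"
    using nn_integral_laplace_tail[of l "- y"] assms by simp
  finally show ?thesis .
qed

text \<open>No atoms: the generation events are open half lines, while the tail formulas are for
  closed ones.\<close>

lemma emeasure_laplace_lessThan: "emeasure (laplace_measure l) {..<y} = emeasure (laplace_measure l) {..y}"
proof -
  have "AE x in lborel. ennreal (laplace_density l x) * indicator {..<y} x
      = ennreal (laplace_density l x) * indicator {..y} x"
    using AE_lborel_singleton[of y] by eventually_elim (auto split: split_indicator)
  then show ?thesis
    by (simp add: laplace_measure_def emeasure_density cong: nn_integral_cong_AE)
qed

lemma real_distribution_laplace_measure:
  assumes "0 < l"
  shows "real_distribution (laplace_measure l)"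
proof -
  have "emeasure (laplace_measure l) ({..<0} \<union> {0..})
      = emeasure (laplace_measure l) {..<0} + emeasure (laplace_measure l) {0..}"
    by (intro plus_emeasure[symmetric]) auto
  also have "\<dots> = ennreal (1 / 2 + 1 / 2)"
    by (subst ennreal_plus)
      (use assms in \<open>simp_all add: emeasure_laplace_lessThan emeasure_laplace_atMost
        emeasure_laplace_atLeast del: ennreal_plus\<close>)
  also have "{..<0} \<union> {0..} = (UNIV :: real set)" by auto
  finally have "emeasure (laplace_measure l) (space (laplace_measure l)) = 1" by simp
  then show ?thesis
    by (intro real_distribution.intro prob_spaceI real_distribution_axioms.intro) auto
qed

section \<open>The policy on the state interval\<close>

lemma borel_measurable_generation:
  "(\<lambda>(s, \<delta>). fst (storage_policy \<alpha>c \<alpha>d Gmax Smax s \<delta>)) \<in> borel_measurable (borel \<Otimes>\<^sub>M borel)"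
  unfolding storage_policy_def if_distrib[where f = fst] fst_conv by measurable

text \<open>Only the parameters are fixed here: everything inside concerns laws and kernels, and the
  random process comes in afterwards.\<close>

locale storage_system =
  fixes \<alpha>c \<alpha>d Gmax Smax l :: real
  assumes \<alpha>c: "0 < \<alpha>c" "\<alpha>c < 1" and \<alpha>d: "0 < \<alpha>d" "\<alpha>d < 1"
    and Gmax: "0 \<le> Gmax" and Smax: "0 \<le> Smax" and l: "0 < l"
begin

abbreviation "step \<equiv> next_storage \<alpha>c \<alpha>d Gmax Smax"
abbreviation "\<nu> \<equiv> laplace_measure l"
abbreviation "K \<equiv> storage_kernel \<alpha>c \<alpha>d Gmax Smax \<nu>"
abbreviation "F \<equiv> stored_power_cdf \<alpha>c \<alpha>d Smax l"

sublocale \<nu>: real_distribution \<nu>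
  by (rule real_distribution_laplace_measure[OF l])

text \<open>The change of stored power in a slot if the capacity imposed no bounds; its slope
  changes at 0 from \<open>1 / \<alpha>d\<close> to \<open>\<alpha>c\<close>.\<close>

definition shift :: "real \<Rightarrow> real" where
  "shift \<delta> = (if 0 \<le> \<delta> then \<alpha>c * \<delta> else \<delta> / \<alpha>d)"

text \<open>The policy charges or discharges as far as the bounds permit, so its branches collapse
  into one clamp; \<open>Gmax\<close> drops out because generated power never enters the
  storage.\<close>

lemma step_eq_clamp:
  assumes "s \<in> {0..Smax}"
  shows "step s \<delta> = max 0 (min Smax (s + shift \<delta>))"
proof -
  have "(Smax - s) / \<alpha>c \<le> \<delta> \<longleftrightarrow> Smax - s \<le> \<alpha>c * \<delta>" "- \<alpha>d * s \<le> \<delta> \<longleftrightarrow> 0 \<le> s + \<delta> / \<alpha>d"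
    using \<alpha>c \<alpha>d by (auto simp: field_simps)
  moreover have "0 \<le> \<delta>" if "(Smax - s) / \<alpha>c \<le> \<delta>"
    using that assms \<alpha>c by (auto intro: order_trans[rotated])
  moreover have "\<delta> / \<alpha>d \<le> 0" if "\<delta> \<le> 0" using that \<alpha>d by (simp add: divide_nonpos_pos)
  moreover have "0 \<le> \<alpha>c * \<delta>" if "0 \<le> \<delta>" using that \<alpha>c by simp
  ultimately show ?thesis
    using assms \<alpha>c \<alpha>d unfolding next_storage_def storage_policy_def shift_def
    by (cases "0 \<le> \<delta>") auto
qed

lemma step_in: "s \<in> {0..Smax} \<Longrightarrow> step s \<delta> \<in> {0..Smax}"
  using Smax by (auto simp: step_eq_clamp)

text \<open>\<open>\<alpha>d * Smax\<close> is the most that a full storage can deliver, so such a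
  deficit drains every state. This common target drives the contraction.\<close>

lemma step_eq_0:
  assumes "s \<in> {0..Smax}" "\<delta> \<le> - (\<alpha>d * Smax)"
  shows "step s \<delta> = 0"
proof -
  have "\<alpha>d * s \<le> \<alpha>d * Smax" using assms \<alpha>d by auto
  then have "\<delta> \<le> - (\<alpha>d * s)" using assms by linarith
  moreover from this have "s + \<delta> / \<alpha>d \<le> 0" using \<alpha>d by (simp add: field_simps)
  moreover have "s = 0" if "0 \<le> \<delta>"
    using calculation that assms(1) divide_nonneg_pos[OF that \<alpha>d(1)] by auto
  moreover have "\<delta> \<le> 0"
    using \<open>\<delta> \<le> - (\<alpha>d * s)\<close> mult_nonneg_nonneg[of \<alpha>d s] \<alpha>d assms(1)
    by (simp del: mult_nonneg_nonneg)
  ultimately have "s + shift \<delta> \<le> 0" by (auto simp: shift_def)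
  then show ?thesis using assms(1) Smax by (auto simp: step_eq_clamp)
qed

text \<open>For \<open>x\<close> in \<open>[0, Smax)\<close> neither clamp affects the comparison,
  so a bound on the next state becomes a half line for \<open>s\<close>, whose mass is a cdf
  value.\<close>

lemma step_le_iff:
  assumes "s \<in> {0..Smax}" "0 \<le> x" "x < Smax"
  shows "step s \<delta> \<le> x \<longleftrightarrow> s \<le> x - shift \<delta>"
  using assms by (auto simp: step_eq_clamp)

section \<open>One-step law and stationarity\<close>

definition step_law :: "real measure \<Rightarrow> real measure" where
  "step_law \<mu> = distr (\<mu> \<Otimes>\<^sub>M \<nu>) borel (\<lambda>(s, \<delta>). step s \<delta>)"

text \<open>Tonelli in both orders: integrating out the input first gives the kernel form of
  stationarity, integrating out the state first gives the form used for the contraction and for the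
  cdf.\<close>

lemma
  assumes "real_distribution \<mu>"
  shows real_distribution_step_law: "real_distribution (step_law \<mu>)"
    and emeasure_step_law_kernel:
      "A \<in> sets borel \<Longrightarrow> emeasure (step_law \<mu>) A = (\<integral>\<^sup>+s. emeasure (K s) A \<partial>\<mu>)"
    and emeasure_step_law_noise:
      "A \<in> sets borel \<Longrightarrow> emeasure (step_law \<mu>) A = (\<integral>\<^sup>+\<delta>. emeasure \<mu> {s. step s \<delta> \<in> A} \<partial>\<nu>)"
proof -
  interpret \<mu>: real_distribution \<mu> by fact
  interpret pair_prob_space \<mu> \<nu> ..
  have [measurable]: "(\<lambda>(s, \<delta>). step s \<delta>) \<in> borel_measurable (\<mu> \<Otimes>\<^sub>M \<nu>)"
    by measurable
  show "real_distribution (step_law \<mu>)"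
    unfolding step_law_def by (rule real_distribution_distr) measurable
  assume [measurable]: "A \<in> sets borel"
  have E: "emeasure (step_law \<mu>) A
      = emeasure (\<mu> \<Otimes>\<^sub>M \<nu>) ((\<lambda>(s, \<delta>). step s \<delta>) -` A \<inter> space (\<mu> \<Otimes>\<^sub>M \<nu>))"
    unfolding step_law_def by (rule emeasure_distr) measurable
  have *: "(\<lambda>(s, \<delta>). step s \<delta>) -` A \<inter> space (\<mu> \<Otimes>\<^sub>M \<nu>) \<in> sets (\<mu> \<Otimes>\<^sub>M \<nu>)"
    by measurable
  have "step s \<in> borel_measurable borel" for s
    by measurable
  then show "emeasure (step_law \<mu>) A = (\<integral>\<^sup>+s. emeasure (K s) A \<partial>\<mu>)"
    unfolding E \<nu>.emeasure_pair_measure_alt[OF *] storage_kernel_def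
    by (intro nn_integral_cong, subst emeasure_distr)
      (auto intro!: arg_cong[where f = "emeasure \<nu>"] simp: space_pair_measure)
  show "emeasure (step_law \<mu>) A = (\<integral>\<^sup>+\<delta>. emeasure \<mu> {s. step s \<delta> \<in> A} \<partial>\<nu>)"
    unfolding E emeasure_pair_measure_alt2[OF *]
    by (auto intro!: nn_integral_cong arg_cong[where f = "emeasure \<mu>"] simp: space_pair_measure)
qed

text \<open>A real-valued version of the state-first formula, so that two laws can be
  subtracted.\<close>

lemma measure_step_law:
  assumes "real_distribution \<mu>" and [measurable]: "A \<in> sets borel"
  shows "integrable \<nu> (\<lambda>\<delta>. measure \<mu> {s. step s \<delta> \<in> A})"
    and "measure (step_law \<mu>) A = (\<integral>\<delta>. measure \<mu> {s. step s \<delta> \<in> A} \<partial>\<nu>)"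
proof -
  interpret \<mu>: real_distribution \<mu> by fact
  interpret S: real_distribution "step_law \<mu>" by (rule real_distribution_step_law) fact
  \<comment> \<open>The pair is swapped because the measurability of section masses is applied to
    sections in the second component.\<close>
  have "(\<lambda>p. step (snd p) (fst p)) \<in> borel_measurable (\<nu> \<Otimes>\<^sub>M \<mu>)"
    by measurable
  from measurable_sets[OF this, of A]
  have "{p. step (snd p) (fst p) \<in> A} \<in> sets (\<nu> \<Otimes>\<^sub>M \<mu>)"
    by (simp add: vimage_def space_pair_measure)
  from \<mu>.measurable_emeasure_Pair[OF this]
  have "(\<lambda>\<delta>. emeasure \<mu> {s. step s \<delta> \<in> A}) \<in> borel_measurable \<nu>"
    by (simp add: vimage_def)
  then have [measurable]: "(\<lambda>\<delta>. measure \<mu> {s. step s \<delta> \<in> A}) \<in> borel_measurable \<nu>"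
    unfolding measure_def by measurable
  show I: "integrable \<nu> (\<lambda>\<delta>. measure \<mu> {s. step s \<delta> \<in> A})"
    by (rule \<nu>.integrable_const_bound[where B = 1]) auto
  have "ennreal (measure (step_law \<mu>) A) = (\<integral>\<^sup>+\<delta>. ennreal (measure \<mu> {s. step s \<delta> \<in> A}) \<partial>\<nu>)"
    using emeasure_step_law_noise[OF assms]
    by (simp add: \<mu>.emeasure_eq_measure S.emeasure_eq_measure)
  also have "\<dots> = ennreal (\<integral>\<delta>. measure \<mu> {s. step s \<delta> \<in> A} \<partial>\<nu>)"
    by (rule nn_integral_eq_integral[OF I]) simp
  finally show "measure (step_law \<mu>) A = (\<integral>\<delta>. measure \<mu> {s. step s \<delta> \<in> A} \<partial>\<nu>)"
    by (simp add: integral_nonneg_AE)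
qed

lemma stationary_iff:
  "stationary_distribution K {0..Smax} \<mu> \<longleftrightarrow>
    real_distribution \<mu> \<and> emeasure \<mu> {0..Smax} = 1 \<and> step_law \<mu> = \<mu>"
proof -
  have "(\<forall>A\<in>sets borel. emeasure \<mu> A = (\<integral>\<^sup>+ s. emeasure (K s) A \<partial>\<mu>)) \<longleftrightarrow> step_law \<mu> = \<mu>"
    if "real_distribution \<mu>"
  proof -
    interpret \<mu>: real_distribution \<mu> by fact
    interpret S: real_distribution "step_law \<mu>" by (rule real_distribution_step_law) fact
    show ?thesis
    proof
      assume "\<forall>A\<in>sets borel. emeasure \<mu> A = (\<integral>\<^sup>+ s. emeasure (K s) A \<partial>\<mu>)"
      then show "step_law \<mu> = \<mu>"
        by (intro measure_eqI) (simp_all add: emeasure_step_law_kernel[OF that])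
    next
      assume "step_law \<mu> = \<mu>"
      then show "\<forall>A\<in>sets borel. emeasure \<mu> A = (\<integral>\<^sup>+ s. emeasure (K s) A \<partial>\<mu>)"
        using emeasure_step_law_kernel[OF that] by simp
    qed
  qed
  then show ?thesis
    unfolding stationary_distribution_def by blast
qed

section \<open>Uniqueness of the stationary law\<close>

lemma AE_in_range:
  assumes "real_distribution \<mu>" "emeasure \<mu> {0..Smax} = 1"
  shows "AE s in \<mu>. s \<in> {0..Smax}"
proof -
  interpret \<mu>: real_distribution \<mu> by fact
  show ?thesis using assms(2) by (intro \<mu>.AE_prob_1) (simp add: measure_def)
qed

text \<open>The clamp formula is available only on \<open>[0, Smax]\<close>; under a law carried by
  that interval an event may be replaced by one that agrees with it there.\<close>

lemma emeasure_cong_range: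
  assumes "real_distribution \<mu>" "emeasure \<mu> {0..Smax} = 1" "A \<in> sets borel" "B \<in> sets borel"
    and "\<And>s. s \<in> {0..Smax} \<Longrightarrow> s \<in> A \<longleftrightarrow> s \<in> B"
  shows "emeasure \<mu> A = emeasure \<mu> B"
proof -
  interpret \<mu>: real_distribution \<mu> by fact
  have "AE s in \<mu>. s \<in> A \<longleftrightarrow> s \<in> B"
    using AE_in_range[OF assms(1,2)] by eventually_elim (rule assms(5))
  then show ?thesis
    using assms(3,4) by (intro emeasure_eq_AE) simp_all
qed

text \<open>Doeblin's argument: a net input below \<open>- \<alpha>d * Smax\<close> empties the storage from every state, so a
  step shrinks the total variation distance by the probability of the complementary event.\<close>

lemma stationary_unique:
  assumes "stationary_distribution K {0..Smax} \<mu>1" "stationary_distribution K {0..Smax} \<mu>2"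
  shows "\<mu>1 = \<mu>2"
proof -
  have r: "real_distribution \<mu>1" "real_distribution \<mu>2"
    and e: "emeasure \<mu>1 {0..Smax} = 1" "emeasure \<mu>2 {0..Smax} = 1"
    and fp: "step_law \<mu>1 = \<mu>1" "step_law \<mu>2 = \<mu>2"
    using assms by (auto simp: stationary_iff)
  interpret \<mu>1: real_distribution \<mu>1 by fact
  interpret \<mu>2: real_distribution \<mu>2 by fact
  define c where "c = measure \<nu> {- (\<alpha>d * Smax)<..}"
  have "measure \<nu> {- (\<alpha>d * Smax)<..} = 1 - measure \<nu> {..- (\<alpha>d * Smax)}"
    by (subst \<nu>.prob_compl[symmetric]) (auto intro!: arg_cong[where f = "measure \<nu>"])
  moreover have "measure \<nu> {..- (\<alpha>d * Smax)} > 0"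
    using emeasure_laplace_atMost[of l "- (\<alpha>d * Smax)"] l \<alpha>d Smax by (simp add: measure_def)
  ultimately have c: "0 \<le> c" "c < 1" by (auto simp: c_def)
  \<comment> \<open>\<open>A\<close> stays arbitrary in the induction, because a step replaces it by
    the preimages \<open>?B \<delta>\<close>.\<close>
  have bound: "\<bar>measure \<mu>1 A - measure \<mu>2 A\<bar> \<le> c ^ n" if "A \<in> sets borel" for n A
    using that
  proof (induction n arbitrary: A)
    case 0
    then show ?case
      using \<mu>1.prob_le_1[of A] \<mu>2.prob_le_1[of A]
        measure_nonneg[of \<mu>1 A] measure_nonneg[of \<mu>2 A]
      unfolding power_0 abs_le_iff by linarith
  next
    case (Suc n)
    note [measurable] = Suc.prems
    let ?B = "\<lambda>\<delta>. {s. step s \<delta> \<in> A}"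
    have m: "?B \<delta> \<in> sets borel" for \<delta> by measurable
    \<comment> \<open>For an emptying input the preimage is all or nothing on the interval, so both
      laws give it the same mass. Integrating the remaining indicator supplies one more factor
      \<open>c\<close>.\<close>
    have d: "\<bar>measure \<mu>1 (?B \<delta>) - measure \<mu>2 (?B \<delta>)\<bar> \<le> c ^ n * indicator {- (\<alpha>d * Smax)<..} \<delta>" for \<delta>
    proof (cases "\<delta> \<le> - (\<alpha>d * Smax)")
      case True
      have "measure \<mu> (?B \<delta>) = (if 0 \<in> A then 1 else 0)"
        if "real_distribution \<mu>" "emeasure \<mu> {0..Smax} = 1" for \<mu>
      proof -
        interpret \<mu>: real_distribution \<mu> by fact
        have "measure \<mu> (?B \<delta>) = measure \<mu> (if 0 \<in> A then UNIV else {})"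
          unfolding measure_def using step_eq_0 True m
          by (intro arg_cong[where f = enn2real] emeasure_cong_range[OF that]) auto
        also have "\<dots> = (if 0 \<in> A then 1 else 0)"
          using \<mu>.prob_space by simp
        finally show ?thesis .
      qed
      then show ?thesis using r e True by simp
    next
      case False
      then show ?thesis using Suc.IH[OF m] by simp
    qed
    have "\<bar>measure \<mu>1 A - measure \<mu>2 A\<bar> = \<bar>\<integral>\<delta>. measure \<mu>1 (?B \<delta>) - measure \<mu>2 (?B \<delta>) \<partial>\<nu>\<bar>"
      using measure_step_law[OF r(1) Suc.prems] measure_step_law[OF r(2) Suc.prems] by (simp add: fp)
    also have "\<dots> \<le> (\<integral>\<delta>. \<bar>measure \<mu>1 (?B \<delta>) - measure \<mu>2 (?B \<delta>)\<bar> \<partial>\<nu>)"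
      by (rule integral_abs_bound)
    also have "\<dots> \<le> (\<integral>\<delta>. c ^ n * indicator {- (\<alpha>d * Smax)<..} \<delta> \<partial>\<nu>)"
    proof (rule integral_mono[OF _ _ d])
      show "integrable \<nu> (\<lambda>\<delta>. \<bar>measure \<mu>1 (?B \<delta>) - measure \<mu>2 (?B \<delta>)\<bar>)"
        using measure_step_law(1)[OF r(1) Suc.prems] measure_step_law(1)[OF r(2) Suc.prems] by simp
      show "integrable \<nu> (\<lambda>\<delta>. c ^ n * indicator {- (\<alpha>d * Smax)<..} \<delta>)"
        by (intro integrable_mult_right integrable_real_indicator) (simp_all add: \<nu>.emeasure_eq_measure)
    qed
    also have "\<dots> = c ^ Suc n" by (simp add: c_def)
    finally show ?case .
  qed
  have "measure \<mu>1 A = measure \<mu>2 A" if "A \<in> sets borel" for A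
  proof -
    have "(\<lambda>n. c ^ n) \<longlonglongrightarrow> 0" using c by (intro LIMSEQ_realpow_zero)
    then have "\<bar>measure \<mu>1 A - measure \<mu>2 A\<bar> \<le> 0"
      using bound[OF that] by (intro LIMSEQ_le_const) auto
    then show ?thesis by simp
  qed
  then show ?thesis
    by (intro measure_eqI) (auto simp: \<mu>1.emeasure_eq_measure \<mu>2.emeasure_eq_measure)
qed

section \<open>The candidate cdf\<close>

text \<open>The decay rate of \<open>F\<close>. It equals
  \<open>l * (1 - \<alpha>) / (2 * \<alpha>c)\<close>, whence
  \<open>\<kappa> * \<alpha>c - l = - l * (1 + \<alpha>) / 2\<close> and \<open>\<kappa> / \<alpha>d
  + l = l * (1 + \<alpha>) / (2 * \<alpha>)\<close>, the two rates met in the invariance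
  computation.\<close>

definition "\<kappa> = (1 / \<alpha>c - \<alpha>d) * l / 2"
definition "\<alpha> = \<alpha>c * \<alpha>d"
definition "N = 1 - \<alpha> * exp (- \<kappa> * Smax)"

lemma \<alpha>: "0 < \<alpha>" "\<alpha> < 1"
  using \<alpha>c \<alpha>d mult_strict_mono[of \<alpha>c 1 \<alpha>d 1] by (auto simp: \<alpha>_def)

lemma \<kappa>: "0 < \<kappa>"
proof -
  have "1 < 1 / \<alpha>c" using \<alpha>c by simp
  then show ?thesis using \<alpha>d l by (simp add: \<kappa>_def)
qed

lemma N: "0 < N"
proof -
  have "\<alpha> * exp (- \<kappa> * Smax) \<le> \<alpha> * 1"
    using \<alpha> \<kappa> Smax by (intro mult_left_mono) auto
  then show ?thesis using \<alpha> unfolding N_def by linarith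
qed

lemma F_eq: "F s = (if s < 0 then 0 else if s < Smax then (1 - (1 + \<alpha>) / 2 * exp (- \<kappa> * s)) / N else 1)"
proof -
  have "- (1 / \<alpha>c - \<alpha>d) * l * s / 2 = - \<kappa> * s" for s
    by (simp only: \<kappa>_def times_divide_eq_left times_divide_eq_right mult_minus_left mult.assoc)
  then show ?thesis by (simp add: stored_power_cdf_def N_def \<alpha>_def)
qed

text \<open>For the upper bound, \<open>\<alpha> \<le> (1 + \<alpha>) / 2\<close> and
  \<open>s < Smax\<close> make the numerator at most \<open>N\<close>.\<close>

lemma F_bounds: "0 \<le> F s" "F s \<le> 1"
proof -
  have "0 \<le> F s \<and> F s \<le> 1"
  proof (cases "0 \<le> s \<and> s < Smax")
    case True
    have "(1 + \<alpha>) / 2 * exp (- \<kappa> * s) \<le> 1 * 1"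
      using True \<alpha> \<kappa> by (intro mult_mono) auto
    moreover have "\<alpha> * exp (- \<kappa> * Smax) \<le> (1 + \<alpha>) / 2 * exp (- \<kappa> * s)"
      using True \<alpha> \<kappa> by (intro mult_mono) auto
    ultimately show ?thesis using True N by (simp add: F_eq N_def)
  qed (auto simp: F_eq)
  then show "0 \<le> F s" "F s \<le> 1" by auto
qed

lemma F_mono: "x \<le> y \<Longrightarrow> F x \<le> F y"
proof (cases "0 \<le> x \<and> y < Smax")
  case True
  assume "x \<le> y"
  then have "(1 + \<alpha>) / 2 * exp (- \<kappa> * y) \<le> (1 + \<alpha>) / 2 * exp (- \<kappa> * x)"
    using \<alpha> \<kappa> by (intro mult_left_mono) auto
  then show ?thesis using True \<open>x \<le> y\<close> N by (simp add: F_eq divide_right_mono)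
next
  case False
  assume "x \<le> y"
  have "F x = 0 \<or> F y = 1" using False Smax \<open>x \<le> y\<close> by (auto simp: F_eq)
  then show ?thesis using F_bounds by auto
qed

text \<open>Just to the right of any point \<open>F\<close> stays on one branch; its jumps, the
  atoms of an empty and of a full storage, show only in left limits.\<close>

lemma F_right_continuous: "continuous (at_right a) F"
proof -
  consider "a < 0" | "0 \<le> a" "a < Smax" | "0 \<le> a" "Smax \<le> a" by linarith
  then show ?thesis
  proof cases
    case 1
    then have "eventually (\<lambda>x. F x = 0) (at_right a)"
      by (auto simp: eventually_at_right F_eq intro!: exI[of _ 0])
    then show ?thesis
      using 1 by (auto simp: continuous_within F_eq[of a] intro: tendsto_eventually)
  next
    case 2
    let ?f = "\<lambda>s. (1 - (1 + \<alpha>) / 2 * exp (- \<kappa> * s)) / N"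
    have "eventually (\<lambda>x. ?f x = F x) (at_right a)"
      using 2 unfolding eventually_at_right[OF 2(2)] by (auto simp: F_eq intro!: exI[of _ Smax])
    moreover have "(?f \<longlongrightarrow> ?f a) (at_right a)"
      using N by (intro tendsto_intros) auto
    ultimately show ?thesis
      using 2 unfolding continuous_within by (subst F_eq) (auto intro: Lim_transform_eventually)
  next
    case 3
    then have "eventually (\<lambda>x. F x = 1) (at_right a)"
      by (auto simp: eventually_at_filter F_eq)
    then show ?thesis
      using 3 by (auto simp: continuous_within F_eq[of a] intro: tendsto_eventually)
  qed
qed

lemma F_at_bot: "(F \<longlongrightarrow> 0) at_bot"
  by (intro tendsto_eventually eventually_mono[OF eventually_gt_at_bot[of 0]])
    (auto simp: F_eq)

lemma F_at_top: "(F \<longlongrightarrow> 1) at_top"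
  by (intro tendsto_eventually eventually_mono[OF eventually_ge_at_top[of Smax]])
    (use Smax in \<open>auto simp: F_eq\<close>)

text \<open>The left limit of a cdf at 0 is the mass of the open half line below 0, so an atom at 0
  still counts for the interval.\<close>

lemma emeasure_range_of_cdf:
  assumes "real_distribution \<mu>" "cdf \<mu> = F"
  shows "emeasure \<mu> {0..Smax} = 1"
proof -
  interpret \<mu>: real_distribution \<mu> by fact
  have "eventually (\<lambda>x. F x = 0) (at_left 0)"
    by (auto simp: eventually_at_filter F_eq)
  then have "measure \<mu> {..<0} = 0"
    using \<mu>.cdf_at_left[of 0] assms(2)
    by (auto intro: tendsto_unique[OF trivial_limit_at_left_real _ tendsto_eventually])
  moreover have "measure \<mu> {..Smax} = 1"
    using fun_cong[OF assms(2), of Smax] Smax by (simp add: cdf_def F_eq)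
  moreover have "measure \<mu> {..Smax} = measure \<mu> {..<0} + measure \<mu> {0..Smax}"
    using Smax by (subst \<mu>.finite_measure_Union[symmetric])
      (auto intro!: arg_cong[where f = "measure \<mu>"])
  ultimately show ?thesis by (simp add: \<mu>.emeasure_eq_measure)
qed

section \<open>Invariance of the candidate cdf\<close>

text \<open>For \<open>x\<close> in \<open>[0, Smax)\<close>, \<open>F (x - shift \<delta>)\<close>
  is 0 above \<open>x / \<alpha>c\<close> and 1 below a negative threshold. In between it is an
  exponential expression with one rate for each sign of \<open>\<delta>\<close>, which leaves two
  explicit integrals and a Laplace tail.\<close>

lemma cdf_step_law:
  assumes "real_distribution \<mu>" "cdf \<mu> = F"
  shows "cdf (step_law \<mu>) = F"
proof
  fix x
  interpret \<mu>: real_distribution \<mu> by fact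
  interpret S: real_distribution "step_law \<mu>" by (rule real_distribution_step_law) fact
  note e = emeasure_range_of_cdf[OF assms]
  have M: "{s. step s \<delta> \<in> {..x}} \<in> sets borel" for \<delta> by measurable
  have E: "emeasure (step_law \<mu>) {..x} = (\<integral>\<^sup>+\<delta>. emeasure \<mu> {s. step s \<delta> \<in> {..x}} \<partial>\<nu>)"
    by (rule emeasure_step_law_noise[OF assms(1)]) simp
  consider "x < 0" | "Smax \<le> x" | "0 \<le> x" "x < Smax" by linarith
  then have "emeasure (step_law \<mu>) {..x} = ennreal (F x)"
  proof cases
    case 1
    have "emeasure \<mu> {s. step s \<delta> \<in> {..x}} = emeasure \<mu> {}" for \<delta>
      using M 1 by (intro emeasure_cong_range[OF assms(1) e])
        (use step_in[of _ \<delta>] in force)+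
    then show ?thesis using 1 by (simp add: E F_eq)
  next
    case 2
    have "emeasure \<mu> {s. step s \<delta> \<in> {..x}} = emeasure \<mu> UNIV" for \<delta>
      using M 2 by (intro emeasure_cong_range[OF assms(1) e])
        (use step_in[of _ \<delta>] in force)+
    then show ?thesis
      using 2 Smax \<mu>.emeasure_space_1 \<nu>.emeasure_space_1 by (simp add: E F_eq)
  next
    case 3
    define A where "A = 1 / N"
    define B where "B = A * (1 + \<alpha>) / 2"
    have FAB: "F y = A - B * exp (- \<kappa> * y)" if "0 \<le> y" "y < Smax" for y
      using that N by (simp add: F_eq A_def B_def field_simps)
    have sh: "emeasure \<mu> {s. step s \<delta> \<in> {..x}} = ennreal (F (x - shift \<delta>))" for \<delta>
    proof -
      have "emeasure \<mu> {s. step s \<delta> \<in> {..x}} = emeasure \<mu> {..x - shift \<delta>}"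
        using M 3 by (intro emeasure_cong_range[OF assms(1) e]) (auto simp: step_le_iff)
      also have "\<dots> = ennreal (F (x - shift \<delta>))"
        using fun_cong[OF assms(2), of "x - shift \<delta>"] by (simp add: \<mu>.emeasure_eq_measure cdf_def)
      finally show ?thesis .
    qed
    \<comment> \<open>\<open>- L\<close> is the input for which \<open>x - shift \<delta>\<close>
      reaches \<open>Smax\<close>; from there downwards the cdf value is 1.\<close>
    define L where "L = \<alpha>d * (Smax - x)"
    have L: "0 < L" using 3 \<alpha>d by (simp add: L_def)
    \<comment> \<open>The density times the exponential formula for \<open>F\<close>, for charging
      and discharging inputs separately.\<close>
    define f1 where "f1 \<delta> = (A - B * exp (- \<kappa> * (x - \<alpha>c * \<delta>))) * (l / 2 * exp (- l * \<delta>))" for \<delta>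
    define f2 where "f2 \<delta> = (A - B * exp (- \<kappa> * (x - \<delta> / \<alpha>d))) * (l / 2 * exp (l * \<delta>))" for \<delta>
    have [measurable]: "f1 \<in> borel_measurable borel" "f2 \<in> borel_measurable borel"
      unfolding f1_def f2_def by measurable
    have I2: "0 \<le> A / 2 - A * \<alpha> / 2 * exp (- \<kappa> * x) - exp (- l * L) / 2"
      "(\<integral>\<^sup>+\<delta>. ennreal (f2 \<delta>) * indicator {- L..0} \<delta> \<partial>lborel)
        = ennreal (A / 2 - A * \<alpha> / 2 * exp (- \<kappa> * x) - exp (- l * L) / 2)"
    proof -
      \<comment> \<open>An antiderivative of \<open>f2\<close>: dividing \<open>B * l / 2\<close> by
        the rate \<open>l * (1 + \<alpha>) / (2 * \<alpha>)\<close> leaves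
        \<open>A * \<alpha> / 2\<close>.\<close>
      define G where "G \<delta> = A / 2 * exp (l * \<delta>) - A * \<alpha> / 2 * exp (- \<kappa> * x) * exp ((l * (1 + \<alpha>) / (2 * \<alpha>)) * \<delta>)" for \<delta>
      have ex: "exp (- \<kappa> * (x - \<delta> / \<alpha>d)) * exp (l * \<delta>) = exp (- \<kappa> * x) * exp ((l * (1 + \<alpha>) / (2 * \<alpha>)) * \<delta>)" for \<delta>
        using \<alpha>c \<alpha>d by (simp add: exp_add[symmetric] \<kappa>_def \<alpha>_def field_simps)
      have f2: "f2 \<delta> = A * l / 2 * exp (l * \<delta>) - B * l / 2 * (exp (- \<kappa> * x) * exp ((l * (1 + \<alpha>) / (2 * \<alpha>)) * \<delta>))" for \<delta>
        unfolding f2_def ex[symmetric] by (simp add: algebra_simps)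
      have D: "(G has_real_derivative f2 \<delta>) (at \<delta> within X)" for \<delta> X
        unfolding f2 G_def using \<alpha>
        by - (rule derivative_eq_intros refl | simp add: B_def field_simps)+
      have pos: "0 \<le> f2 \<delta>" if "\<delta> \<in> {- L..0}" for \<delta>
      proof -
        \<comment> \<open>At \<open>\<delta> = - L\<close> the argument is \<open>Smax\<close>,
          where \<open>F\<close> leaves its exponential formula, so the sign is read off the formula
          itself for every nonnegative \<open>y\<close>.\<close>
        have "0 \<le> A - B * exp (- \<kappa> * y)" if "0 \<le> y" for y
        proof -
          have "(1 + \<alpha>) / 2 * exp (- \<kappa> * y) \<le> 1 * 1"
            using that \<alpha> \<kappa> by (intro mult_mono) auto
          then have "A * ((1 + \<alpha>) / 2 * exp (- \<kappa> * y)) \<le> A * 1"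
            using N by (intro mult_left_mono) (auto simp: A_def)
          then show ?thesis by (simp add: B_def)
        qed
        moreover have "0 \<le> x - \<delta> / \<alpha>d"
          using that 3 \<alpha>d divide_nonpos_pos[of \<delta> \<alpha>d] by auto
        ultimately show ?thesis using l by (simp add: f2_def)
      qed
      have G: "G 0 - G (- L) = A / 2 - A * \<alpha> / 2 * exp (- \<kappa> * x) - exp (- l * L) / 2"
      proof -
        \<comment> \<open>This is where the normalization \<open>N\<close> fits: since
          \<open>A * N = 1\<close>, the endpoint \<open>- L\<close> contributes
          \<open>exp (- l * L) / 2\<close>, which later cancels against the tail
          \<open>I3\<close>.\<close>
        have "exp (- \<kappa> * x) * exp ((l * (1 + \<alpha>) / (2 * \<alpha>)) * - L) = exp (- \<kappa> * Smax) * exp (- l * L)"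
          using \<alpha>c \<alpha>d by (simp add: exp_add[symmetric] \<kappa>_def \<alpha>_def L_def field_simps)
        then have "G (- L) = A * N / 2 * exp (- l * L)"
          by (simp add: G_def N_def algebra_simps)
        then show ?thesis using N by (simp add: G_def A_def)
      qed
      have "(\<integral>\<^sup>+\<delta>. ennreal (f2 \<delta>) * indicator {- L..0} \<delta> \<partial>lborel) = ennreal (G 0 - G (- L))"
        by (rule nn_integral_FTC_Icc) (use L D pos in auto)
      \<comment> \<open>\<open>ennreal\<close> sends negative reals to 0, so the pieces can be added
        as reals only once each is known to be nonnegative.\<close>
      moreover have "G (- L) \<le> G 0"
        by (rule DERIV_nonneg_imp_nondecreasing) (use L D pos in fastforce)+
      ultimately show "0 \<le> A / 2 - A * \<alpha> / 2 * exp (- \<kappa> * x) - exp (- l * L) / 2"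
        "(\<integral>\<^sup>+\<delta>. ennreal (f2 \<delta>) * indicator {- L..0} \<delta> \<partial>lborel)
        = ennreal (A / 2 - A * \<alpha> / 2 * exp (- \<kappa> * x) - exp (- l * L) / 2)"
        using G by auto
    qed
    have I3: "(\<integral>\<^sup>+\<delta>. ennreal (laplace_density l \<delta>) * indicator {..- L} \<delta> \<partial>lborel) = ennreal (exp (- l * L) / 2)"
      using emeasure_laplace_atMost[of l "- L"] l L by (simp add: laplace_measure_def emeasure_density)
    have I1: "(\<integral>\<^sup>+\<delta>. ennreal (f1 \<delta>) * indicator {0..x / \<alpha>c} \<delta> \<partial>lborel) = ennreal (A / 2 * (1 - exp (- \<kappa> * x)))"
    proof -
      \<comment> \<open>Here the rate is \<open>l * (1 + \<alpha>) / 2\<close>, and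
        \<open>B * l / 2\<close> divided by it is \<open>A / 2\<close>.\<close>
      define G where "G \<delta> = - A / 2 * exp (- l * \<delta>) + A / 2 * exp (- \<kappa> * x) * exp (- (l * (1 + \<alpha>) / 2) * \<delta>)" for \<delta>
      have ex: "exp (- \<kappa> * (x - \<alpha>c * \<delta>)) * exp (- l * \<delta>) = exp (- \<kappa> * x) * exp (- (l * (1 + \<alpha>) / 2) * \<delta>)" for \<delta>
        using \<alpha>c by (simp add: exp_add[symmetric] \<kappa>_def \<alpha>_def field_simps)
      have f1: "f1 \<delta> = A * l / 2 * exp (- l * \<delta>) - B * l / 2 * (exp (- \<kappa> * x) * exp (- (l * (1 + \<alpha>) / 2) * \<delta>))" for \<delta>
        unfolding f1_def ex[symmetric] by (simp add: algebra_simps)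
      have D: "(G has_real_derivative f1 \<delta>) (at \<delta> within X)" for \<delta> X
        unfolding f1 G_def
        by (rule derivative_eq_intros refl | simp add: B_def field_simps)+
      have pos: "0 \<le> f1 \<delta>" if "\<delta> \<in> {0..x / \<alpha>c}" for \<delta>
      proof -
        have "0 \<le> x - \<alpha>c * \<delta>" using that \<alpha>c by (simp add: field_simps)
        moreover have "x - \<alpha>c * \<delta> < Smax" using that 3 mult_nonneg_nonneg[of \<alpha>c \<delta>] \<alpha>c
          by (simp del: mult_nonneg_nonneg)
        ultimately show ?thesis
          using F_bounds(1)[of "x - \<alpha>c * \<delta>"] l by (simp add: f1_def FAB)
      qed
      have "(\<integral>\<^sup>+\<delta>. ennreal (f1 \<delta>) * indicator {0..x / \<alpha>c} \<delta> \<partial>lborel) = ennreal (G (x / \<alpha>c) - G 0)"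
        by (rule nn_integral_FTC_Icc) (use 3 \<alpha>c D pos in auto)
      also have "G (x / \<alpha>c) - G 0 = A / 2 * (1 - exp (- \<kappa> * x))"
      proof -
        \<comment> \<open>At \<open>\<delta> = x / \<alpha>c\<close> the two exponentials coincide
          and \<open>G\<close> vanishes, so only \<open>- G 0\<close> remains.\<close>
        have "exp (- \<kappa> * x) * exp (- (l * (1 + \<alpha>) / 2) * (x / \<alpha>c)) = exp (- l * (x / \<alpha>c))"
          using \<alpha>c by (simp add: exp_add[symmetric] \<kappa>_def \<alpha>_def field_simps)
        then show ?thesis by (simp add: G_def algebra_simps)
      qed
      finally show ?thesis .
    qed
    have "emeasure (step_law \<mu>) {..x}
        = (\<integral>\<^sup>+\<delta>. ennreal (laplace_density l \<delta>) * ennreal (F (x - shift \<delta>)) \<partial>lborel)"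
      unfolding E sh laplace_measure_def
      by (subst nn_integral_density) (auto simp: stored_power_cdf_def shift_def)
    also have "\<dots> = (\<integral>\<^sup>+\<delta>. (ennreal (f1 \<delta>) * indicator {0..x / \<alpha>c} \<delta> + ennreal (f2 \<delta>) * indicator {- L..0} \<delta>)
          + ennreal (laplace_density l \<delta>) * indicator {..- L} \<delta> \<partial>lborel)"
    proof (rule nn_integral_cong_AE)
      \<comment> \<open>The closed intervals overlap at 0 and \<open>- L\<close>, hence equality
        only almost everywhere.\<close>
      show "AE \<delta> in lborel. ennreal (laplace_density l \<delta>) * ennreal (F (x - shift \<delta>))
          = (ennreal (f1 \<delta>) * indicator {0..x / \<alpha>c} \<delta> + ennreal (f2 \<delta>) * indicator {- L..0} \<delta>)
          + ennreal (laplace_density l \<delta>) * indicator {..- L} \<delta>"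
        using AE_lborel_singleton[of 0] AE_lborel_singleton[of "- L"]
      proof eventually_elim
        case (elim \<delta>)
        consider "0 < \<delta>" "\<delta> \<le> x / \<alpha>c" | "0 < \<delta>" "x / \<alpha>c < \<delta>" | "\<delta> < 0" "- L < \<delta>" | "\<delta> < - L"
          using elim by linarith
        then show ?case
        proof cases
          case 1
          then have "0 \<le> x - \<alpha>c * \<delta>" using \<alpha>c by (simp add: field_simps)
          moreover have "x - \<alpha>c * \<delta> < Smax" using 1 3 mult_pos_pos[OF \<alpha>c(1) 1(1)] by linarith
          ultimately have "f1 \<delta> = F (x - shift \<delta>) * laplace_density l \<delta>"
            using 1 by (simp add: f1_def shift_def laplace_density_def FAB)
          then show ?thesis
            using 1 L laplace_density_nonneg[OF l, of \<delta>] F_bounds(1)[of "x - shift \<delta>"]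
            by (simp add: ennreal_mult mult.commute)
        next
          case 2
          then have "x - \<alpha>c * \<delta> < 0" using \<alpha>c by (simp add: field_simps)
          then show ?thesis using 2 L by (simp add: shift_def F_eq)
        next
          case neg: 3
          then have "x - \<delta> / \<alpha>d < Smax" using \<alpha>d by (simp add: L_def field_simps)
          moreover have "0 \<le> x - \<delta> / \<alpha>d"
            using 3 neg divide_neg_pos[OF neg(1) \<alpha>d(1)] by linarith
          ultimately have "f2 \<delta> = F (x - shift \<delta>) * laplace_density l \<delta>"
            using neg by (simp add: f2_def shift_def laplace_density_def FAB)
          then show ?thesis
            using neg laplace_density_nonneg[OF l, of \<delta>] F_bounds(1)[of "x - shift \<delta>"]
            by (simp add: ennreal_mult mult.commute)
        next
          case 4
          then have "Smax \<le> x - \<delta> / \<alpha>d" using \<alpha>d by (simp add: L_def field_simps)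
          then show ?thesis using 4 L Smax by (simp add: shift_def F_eq)
        qed
      qed
    qed
    also have "\<dots> = (\<integral>\<^sup>+\<delta>. ennreal (f1 \<delta>) * indicator {0..x / \<alpha>c} \<delta> \<partial>lborel)
        + (\<integral>\<^sup>+\<delta>. ennreal (f2 \<delta>) * indicator {- L..0} \<delta> \<partial>lborel)
        + (\<integral>\<^sup>+\<delta>. ennreal (laplace_density l \<delta>) * indicator {..- L} \<delta> \<partial>lborel)"
      by (subst nn_integral_add; (subst nn_integral_add)?) auto
    also note I3
    also note I1
    also note I2(2)
    also have "ennreal (A / 2 * (1 - exp (- \<kappa> * x))) + ennreal (A / 2 - A * \<alpha> / 2 * exp (- \<kappa> * x) - exp (- l * L) / 2)
        + ennreal (exp (- l * L) / 2) = ennreal (F x)"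
    proof -
      have A0: "0 < A" using N by (simp add: A_def)
      have e1: "0 \<le> A / 2 * (1 - exp (- \<kappa> * x))" using A0 3 \<kappa> by simp
      \<comment> \<open>The terms in \<open>L\<close> cancel, and the coefficients
        \<open>A / 2\<close> and \<open>A * \<alpha> / 2\<close> of
        \<open>exp (- \<kappa> * x)\<close> add up to \<open>B\<close>.\<close>
      have "A / 2 * (1 - exp (- \<kappa> * x)) + (A / 2 - A * \<alpha> / 2 * exp (- \<kappa> * x) - exp (- l * L) / 2)
          + exp (- l * L) / 2 = F x"
        unfolding FAB[OF 3] B_def by (simp add: field_simps)
      moreover have "0 \<le> exp (- l * L) / 2" by simp
      ultimately show ?thesis
        using e1 I2(1) by (metis add_nonneg_nonneg ennreal_plus)
    qed
    finally show ?thesis .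
  qed
  then show "cdf (step_law \<mu>) x = F x"
    using F_bounds(1)[of x] by (simp add: cdf_def S.emeasure_eq_measure)
qed

text \<open>A real distribution is determined by its cdf, so preserving the cdf in a step means
  preserving the law.\<close>

lemma stationary_of_cdf:
  assumes "real_distribution \<mu>" "cdf \<mu> = F"
  shows "stationary_distribution K {0..Smax} \<mu>"
  unfolding stationary_iff
  using assms emeasure_range_of_cdf[OF assms] cdf_step_law[OF assms] real_distribution_step_law[of \<mu>]
  by (auto intro: cdf_unique)

lemma stationary_interval_measure: "stationary_distribution K {0..Smax} (interval_measure F)"
  using F_mono F_right_continuous F_at_bot F_at_top
  by (intro stationary_of_cdf real_distribution_interval_measure cdf_interval_measure)

lemma stationary_cdf:
  assumes "stationary_distribution K {0..Smax} \<mu>"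
  shows "cdf \<mu> = F"
proof -
  have "\<mu> = interval_measure F"
    by (rule stationary_unique[OF assms stationary_interval_measure])
  then show ?thesis
    using F_mono F_right_continuous F_at_bot by (simp add: cdf_interval_measure)
qed

section \<open>The law of the generation\<close>

text \<open>The integrand is the probability of an input that drains state \<open>s\<close>. For
  \<open>Smax > 0\<close> its mean is the chance of an empty next state, which by stationarity is
  the atom \<open>F 0\<close>; this replaces an integration against the storage law.\<close>

lemma nn_integral_exp_storage:
  assumes "real_distribution \<mu>" "cdf \<mu> = F"
  shows "(\<integral>\<^sup>+s. ennreal (exp (- (l * \<alpha>d * s)) / 2) \<partial>\<mu>) = ennreal ((1 - \<alpha>) / (2 * N))"
proof (cases "Smax = 0")
  \<comment> \<open>With \<open>Smax = 0\<close> every input leads to state 0, so emptiness is no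
    longer a condition on the input. The state is 0 almost surely and
    \<open>N = 1 - \<alpha>\<close>, so both sides are one half.\<close>
  case True
  interpret \<mu>: real_distribution \<mu> by fact
  have "(\<integral>\<^sup>+s. ennreal (exp (- (l * \<alpha>d * s)) / 2) \<partial>\<mu>) = (\<integral>\<^sup>+s. ennreal (1 / 2) \<partial>\<mu>)"
    using AE_in_range[OF assms(1) emeasure_range_of_cdf[OF assms]]
    by (intro nn_integral_cong_AE, eventually_elim) (simp add: True)
  also have "\<dots> = ennreal (1 / 2)"
    using \<mu>.emeasure_space_1 by simp
  also have "1 / 2 = (1 - \<alpha>) / (2 * N)"
    using True \<alpha> unfolding N_def by simp
  finally show ?thesis .
next
  case False
  then have S: "0 < Smax" using Smax by simp
  interpret \<mu>: real_distribution \<mu> by fact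
  have "(\<integral>\<^sup>+s. ennreal (exp (- (l * \<alpha>d * s)) / 2) \<partial>\<mu>) = (\<integral>\<^sup>+s. emeasure (K s) {..0} \<partial>\<mu>)"
    using AE_in_range[OF assms(1) emeasure_range_of_cdf[OF assms]]
  proof (intro nn_integral_cong_AE, eventually_elim)
    case (elim s)
    have s: "0 \<le> \<alpha>d * s" using elim \<alpha>d by simp
    have "step s \<delta> \<le> 0 \<longleftrightarrow> \<delta> \<le> - (\<alpha>d * s)" for \<delta>
    proof (cases "0 \<le> \<delta>")
      case True
      then have "step s \<delta> \<le> 0 \<longleftrightarrow> s + \<alpha>c * \<delta> \<le> 0"
        using step_le_iff[OF elim(2) order_refl S, of \<delta>] by (auto simp: shift_def)
      also have "\<dots> \<longleftrightarrow> s = 0 \<and> \<alpha>c * \<delta> = 0"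
      proof -
        have "0 \<le> \<alpha>c * \<delta>" using True \<alpha>c by simp
        moreover have "0 \<le> s" using elim(2) by simp
        ultimately show ?thesis by linarith
      qed
      also have "\<dots> \<longleftrightarrow> s = 0 \<and> \<delta> = 0" using \<alpha>c by simp
      also have "\<dots> \<longleftrightarrow> \<delta> \<le> - (\<alpha>d * s)"
      proof -
        have "\<alpha>d * s = 0 \<longleftrightarrow> s = 0" using \<alpha>d by simp
        then show ?thesis using True s by linarith
      qed
      finally show ?thesis .
    next
      case False
      then show ?thesis
        using step_le_iff[OF elim(2) order_refl S, of \<delta>] \<alpha>d
        by (auto simp: shift_def field_simps)
    qed
    then have "step s -` {..0} = {..- (\<alpha>d * s)}" by auto
    moreover have "step s \<in> borel_measurable borel" by measurable
    ultimately have "emeasure (K s) {..0} = emeasure \<nu> {..- (\<alpha>d * s)}"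
      unfolding storage_kernel_def by (subst emeasure_distr) auto
    then show ?case
      using emeasure_laplace_atMost[OF l, of "- (\<alpha>d * s)"] s by (simp add: mult.assoc)
  qed
  also have "\<dots> = emeasure \<mu> {..0}"
    using stationary_of_cdf[OF assms] by (simp add: stationary_distribution_def)
  also have "\<dots> = ennreal (F 0)"
    using fun_cong[OF assms(2), of 0] by (simp add: \<mu>.emeasure_eq_measure cdf_def)
  also have "F 0 = (1 - \<alpha>) / (2 * N)"
    using S N by (simp add: F_eq field_simps)
  finally show ?thesis .
qed

abbreviation "generation s \<delta> \<equiv> fst (storage_policy \<alpha>c \<alpha>d Gmax Smax s \<delta>)"

text \<open>Generation covers, up to its capacity, the part of the deficit that remains after the
  storage has delivered \<open>\<alpha>d * s\<close>.\<close>

lemma generation_eq_clamp: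
  assumes "s \<in> {0..Smax}"
  shows "generation s \<delta> = max 0 (min Gmax (- \<delta> - \<alpha>d * s))"
proof -
  have "0 \<le> \<alpha>d * s" using assms \<alpha>d by simp
  moreover have "0 \<le> \<delta>" if "(Smax - s) / \<alpha>c \<le> \<delta>"
    using that assms \<alpha>c by (auto intro: order_trans[rotated])
  ultimately show ?thesis
    using Gmax unfolding storage_policy_def by auto
qed

text \<open>The excess event \<open>{g<..}\<close> is convenient because for
  \<open>0 \<le> g\<close> and \<open>g < Gmax\<close> it is a left tail of the input, whose
  probability splits into a factor in \<open>g\<close> and a factor in \<open>s\<close>.\<close>

lemma cdf_generation:
  assumes "real_distribution \<mu>" "cdf \<mu> = F"
  shows "cdf (distr (\<mu> \<Otimes>\<^sub>M \<nu>) borel (\<lambda>(s, \<delta>). generation s \<delta>)) = generation_cdf \<alpha>c \<alpha>d Gmax Smax l"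
proof
  fix g
  interpret \<mu>: real_distribution \<mu> by fact
  interpret pair_prob_space \<mu> \<nu> ..
  note range = AE_in_range[OF assms(1) emeasure_range_of_cdf[OF assms]]
  note [measurable] = borel_measurable_generation[of \<alpha>c \<alpha>d Gmax Smax]
  have m: "(\<lambda>(s, \<delta>). generation s \<delta>) \<in> borel_measurable (\<mu> \<Otimes>\<^sub>M \<nu>)" by measurable
  let ?D = "distr (\<mu> \<Otimes>\<^sub>M \<nu>) borel (\<lambda>(s, \<delta>). generation s \<delta>)"
  interpret D: real_distribution ?D
    using m by (rule real_distribution_distr)
  have E: "emeasure ?D {g<..} = (\<integral>\<^sup>+s. emeasure \<nu> {\<delta>. g < generation s \<delta>} \<partial>\<mu>)"
  proof -
    have "(\<lambda>(s, \<delta>). generation s \<delta>) -` {g<..} \<inter> space (\<mu> \<Otimes>\<^sub>M \<nu>) \<in> sets (\<mu> \<Otimes>\<^sub>M \<nu>)"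
      by (rule measurable_sets[OF m]) simp
    then show ?thesis
      by (subst emeasure_distr[OF m], simp, subst \<nu>.emeasure_pair_measure_alt)
        (auto intro!: nn_integral_cong arg_cong[where f = "emeasure \<nu>"] simp: space_pair_measure)
  qed
  define c where "c = (1 - \<alpha>) / (2 * N)"
  have c: "0 \<le> c" using \<alpha> N by (simp add: c_def)
  consider "g < 0" | "Gmax \<le> g" | "0 \<le> g" "g < Gmax" by linarith
  then have "emeasure ?D {g<..} = ennreal (if g < 0 then 1 else if Gmax \<le> g then 0 else exp (- l * g) * c)"
  proof cases
    case 1
    have "emeasure ?D {g<..} = (\<integral>\<^sup>+s. emeasure \<nu> UNIV \<partial>\<mu>)"
      unfolding E using range
      by (intro nn_integral_cong_AE, eventually_elim)
        (use 1 in \<open>auto simp: generation_eq_clamp intro!: arg_cong[where f = "emeasure \<nu>"]\<close>)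
    then show ?thesis using 1 \<mu>.emeasure_space_1 \<nu>.emeasure_space_1 by simp
  next
    case 2
    have "emeasure ?D {g<..} = (\<integral>\<^sup>+s. emeasure \<nu> {} \<partial>\<mu>)"
      unfolding E using range
    proof (intro nn_integral_cong_AE, eventually_elim)
      case (elim s)
      then have "{\<delta>. g < generation s \<delta>} = {}"
        using 2 Gmax by (auto simp: generation_eq_clamp)
      then show ?case by simp
    qed
    then show ?thesis using 2 Gmax by simp
  next
    case 3
    have "emeasure ?D {g<..} = (\<integral>\<^sup>+s. ennreal (exp (- l * g)) * ennreal (exp (- (l * \<alpha>d * s)) / 2) \<partial>\<mu>)"
      unfolding E using range
    proof (intro nn_integral_cong_AE, eventually_elim)
      case (elim s)
      \<comment> \<open>\<open>g < Gmax\<close> makes the cap irrelevant to the comparison, and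
        \<open>0 \<le> g\<close> does the same for the floor at 0.\<close>
      have "{\<delta>. g < generation s \<delta>} = {..<- g - \<alpha>d * s}"
        using elim 3 by (auto simp: generation_eq_clamp)
      moreover have "0 \<le> \<alpha>d * s" using elim \<alpha>d by simp
      ultimately have "emeasure \<nu> {\<delta>. g < generation s \<delta>} = ennreal (exp (l * (- g - \<alpha>d * s)) / 2)"
        using 3 l by (simp add: emeasure_laplace_lessThan emeasure_laplace_atMost)
      also have "exp (l * (- g - \<alpha>d * s)) / 2 = exp (- l * g) * (exp (- (l * \<alpha>d * s)) / 2)"
        by (simp add: exp_add[symmetric] algebra_simps)
      finally show ?case by (simp only:) (rule ennreal_mult; simp)
    qed
    also have "\<dots> = ennreal (exp (- l * g)) * ennreal c"
      unfolding c_def nn_integral_exp_storage[OF assms, symmetric] by (rule nn_integral_cmult) simp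
    finally show ?thesis using 3 c by (simp add: ennreal_mult)
  qed
  then have "measure ?D {g<..} = (if g < 0 then 1 else if Gmax \<le> g then 0 else exp (- l * g) * c)"
    using c by (simp add: measure_def)
  moreover have "measure ?D {..g} = 1 - measure ?D {g<..}"
    by (subst D.prob_compl[symmetric]) (auto intro!: arg_cong[where f = "measure ?D"])
  moreover have "- (1 / \<alpha>c - \<alpha>d) * l * Smax / 2 = - \<kappa> * Smax"
    by (simp only: \<kappa>_def times_divide_eq_left times_divide_eq_right mult_minus_left mult.assoc)
  ultimately show "cdf ?D g = generation_cdf \<alpha>c \<alpha>d Gmax Smax l g"
    by (simp add: cdf_def generation_cdf_def c_def N_def \<alpha>_def mult.commute)
qed

end

section \<open>From laws to the random process\<close>

text \<open>The process started at index 0 is adapted: \<open>S i\<close> is a function of \<open>S 0\<close> and of the inputs before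
  slot \<open>i\<close>, hence independent of \<open>\<Delta> i\<close>.\<close>

lemma (in prob_space) distr_adapted_pair:
  fixes S \<Delta> :: "nat \<Rightarrow> 'a \<Rightarrow> real"
  assumes ind: "indep_vars (\<lambda>_. borel) (case_nat (S 0) \<Delta>) UNIV"
    and T [measurable]: "(\<lambda>(s, \<delta>). T s \<delta>) \<in> borel_measurable (borel \<Otimes>\<^sub>M borel)"
    and rec: "\<And>i \<omega>. \<omega> \<in> space M \<Longrightarrow> S (Suc i) \<omega> = T (S i \<omega>) (\<Delta> i \<omega>)"
  shows "S i \<in> borel_measurable M"
    and "distr M (borel \<Otimes>\<^sub>M borel) (\<lambda>\<omega>. (S i \<omega>, \<Delta> i \<omega>)) = distr M borel (S i) \<Otimes>\<^sub>M distr M borel (\<Delta> i)"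
proof -
  let ?X = "case_nat (S 0) \<Delta>"
  let ?B = "\<lambda>_ :: nat. borel :: real measure"
  \<comment> \<open>Coordinate 0 of \<open>?X\<close> is the initial state and coordinate
    \<open>Suc j\<close> is \<open>\<Delta> j\<close>, so \<open>{..i}\<close> holds exactly
    \<open>S 0\<close> and the inputs before slot \<open>i\<close>.\<close>
  have "\<exists>f \<in> borel_measurable (PiM {..i} ?B). \<forall>\<omega>\<in>space M. S i \<omega> = f (\<lambda>j\<in>{..i}. ?X j \<omega>)"
  proof (induction i)
    case 0
    show ?case
      by (rule bexI[where x = "\<lambda>x. x 0"]) auto
  next
    case (Suc i)
    then obtain f where f [measurable]: "f \<in> borel_measurable (PiM {..i} ?B)"
      and eq: "\<And>\<omega>. \<omega> \<in> space M \<Longrightarrow> S i \<omega> = f (\<lambda>j\<in>{..i}. ?X j \<omega>)" by blast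
    have [measurable]: "(\<lambda>x. restrict x {..i}) \<in> PiM {..Suc i} ?B \<rightarrow>\<^sub>M PiM {..i} ?B"
      by (rule measurable_restrict_subset) auto
    have [measurable]: "(\<lambda>x. x (Suc i)) \<in> borel_measurable (PiM {..Suc i} ?B)"
      by (rule measurable_component_singleton) simp
    show ?case
    proof (rule bexI[where x = "\<lambda>x. T (f (restrict x {..i})) (x (Suc i))"])
      have "restrict (\<lambda>j\<in>{..Suc i}. ?X j \<omega>) {..i} = (\<lambda>j\<in>{..i}. ?X j \<omega>)" for \<omega>
        by (auto simp: fun_eq_iff)
      then show "\<forall>\<omega>\<in>space M. S (Suc i) \<omega>
          = T (f (restrict (\<lambda>j\<in>{..Suc i}. ?X j \<omega>) {..i})) ((\<lambda>j\<in>{..Suc i}. ?X j \<omega>) (Suc i))"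
        by (simp add: rec eq)
    qed measurable
  qed
  then obtain f where f: "f \<in> borel_measurable (PiM {..i} ?B)"
    and eq: "\<And>\<omega>. \<omega> \<in> space M \<Longrightarrow> S i \<omega> = f (\<lambda>j\<in>{..i}. ?X j \<omega>)" by blast
  \<comment> \<open>The blocks \<open>{..i}\<close> and \<open>{Suc i}\<close> of the independent
    family are disjoint, and the second one carries \<open>\<Delta> i\<close>.\<close>
  have "indep_var borel (f \<circ> (\<lambda>\<omega>. \<lambda>j\<in>{..i}. ?X j \<omega>))
      borel ((\<lambda>x. x (Suc i)) \<circ> (\<lambda>\<omega>. \<lambda>j\<in>{Suc i}. ?X j \<omega>))"
    by (rule indep_var_compose[OF indep_var_restrict[OF ind] f]) auto
  then have *: "f \<circ> (\<lambda>\<omega>. \<lambda>j\<in>{..i}. ?X j \<omega>) \<in> borel_measurable M"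
    "distr M borel (f \<circ> (\<lambda>\<omega>. \<lambda>j\<in>{..i}. ?X j \<omega>)) \<Otimes>\<^sub>M distr M borel (\<Delta> i)
      = distr M (borel \<Otimes>\<^sub>M borel) (\<lambda>\<omega>. ((f \<circ> (\<lambda>\<omega>. \<lambda>j\<in>{..i}. ?X j \<omega>)) \<omega>, \<Delta> i \<omega>))"
    by (simp_all add: indep_var_distribution_eq comp_def)
  show "S i \<in> borel_measurable M"
    using *(1) by (rule measurable_cong[THEN iffD1, rotated]) (simp add: eq)
  show "distr M (borel \<Otimes>\<^sub>M borel) (\<lambda>\<omega>. (S i \<omega>, \<Delta> i \<omega>)) = distr M borel (S i) \<Otimes>\<^sub>M distr M borel (\<Delta> i)"
  proof -
    have "distr M borel (S i) = distr M borel (f \<circ> (\<lambda>\<omega>. \<lambda>j\<in>{..i}. ?X j \<omega>))"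
      "distr M (borel \<Otimes>\<^sub>M borel) (\<lambda>\<omega>. (S i \<omega>, \<Delta> i \<omega>))
        = distr M (borel \<Otimes>\<^sub>M borel) (\<lambda>\<omega>. ((f \<circ> (\<lambda>\<omega>. \<lambda>j\<in>{..i}. ?X j \<omega>)) \<omega>, \<Delta> i \<omega>))"
      by (auto intro!: distr_cong simp: eq)
    then show ?thesis using *(2) by simp
  qed
qed

text \<open>Slots are numbered from 0. Prepending \<open>S 0\<close> to the inputs by
  \<open>case_nat\<close> lets one hypothesis express both that the inputs are independent and that
  the initial state is independent of them.\<close>

theorem proposition3:
  fixes \<alpha>c \<alpha>d Gmax Smax l :: real
    and M :: "'a measure"
    and \<Delta> S G C D :: "nat \<Rightarrow> 'a \<Rightarrow> real"
  assumes "0 < \<alpha>c" "\<alpha>c < 1" "0 < \<alpha>d" "\<alpha>d < 1" "0 \<le> Gmax" "0 \<le> Smax" "0 < l"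
    and "prob_space M"
    and "prob_space.indep_vars M (\<lambda>_. borel) (case_nat (S 0) \<Delta>) UNIV"
    and "\<And>i. distributed M lborel (\<Delta> i) (\<lambda>x. ennreal (laplace_density l x))"
    and "\<And>\<omega>. \<omega> \<in> space M \<Longrightarrow> S 0 \<omega> \<in> {0..Smax}"
    and "\<And>i \<omega>. \<omega> \<in> space M \<Longrightarrow>
           (G i \<omega>, C i \<omega>, D i \<omega>) = storage_policy \<alpha>c \<alpha>d Gmax Smax (S i \<omega>) (\<Delta> i \<omega>)"
    and "\<And>i \<omega>. \<omega> \<in> space M \<Longrightarrow>
           S (Suc i) \<omega> = S i \<omega> + \<alpha>c * C i \<omega> - 1 / \<alpha>d * D i \<omega>"
  shows "(\<exists>!\<mu>. stationary_distribution
                 (storage_kernel \<alpha>c \<alpha>d Gmax Smax (laplace_measure l)) {0..Smax} \<mu>) \<and>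
         (\<forall>\<mu>. stationary_distribution
                 (storage_kernel \<alpha>c \<alpha>d Gmax Smax (laplace_measure l)) {0..Smax} \<mu> \<longrightarrow>
               cdf \<mu> = stored_power_cdf \<alpha>c \<alpha>d Smax l) \<and>
         (\<forall>i. cdf (distr M borel (S i)) = stored_power_cdf \<alpha>c \<alpha>d Smax l \<longrightarrow>
               cdf (distr M borel (S (Suc i))) = stored_power_cdf \<alpha>c \<alpha>d Smax l \<and>
               cdf (distr M borel (G i)) = generation_cdf \<alpha>c \<alpha>d Gmax Smax l)"
proof -
  interpret storage_system \<alpha>c \<alpha>d Gmax Smax l
    by unfold_locales fact+
  interpret M: prob_space M by fact
  have rec: "S (Suc i) \<omega> = step (S i \<omega>) (\<Delta> i \<omega>)" if "\<omega> \<in> space M" for i \<omega>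
    using assms(13)[OF that, of i] unfolding next_storage_def assms(12)[OF that, of i, symmetric] by simp
  note adapted = M.distr_adapted_pair[OF assms(9) measurable_next_storage rec]
  have \<Delta>: "\<Delta> i \<in> borel_measurable M" "distr M borel (\<Delta> i) = \<nu>" for i
    using distributed_measurable[OF assms(10)] distributed_distr_eq_density[OF assms(10)]
    by (auto simp: laplace_measure_def cong: distr_cong)
  \<comment> \<open>Stated for a general \<open>h\<close> because it serves twice: for the next
    state and for the generation.\<close>
  have law: "distr M borel (\<lambda>\<omega>. h (S i \<omega>) (\<Delta> i \<omega>))
      = distr (distr M borel (S i) \<Otimes>\<^sub>M \<nu>) borel (\<lambda>(s, \<delta>). h s \<delta>)"
    if "(\<lambda>(s, \<delta>). h s \<delta>) \<in> borel_measurable (borel \<Otimes>\<^sub>M borel)" for h i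
  proof -
    have [measurable]: "S i \<in> borel_measurable M" "\<Delta> i \<in> borel_measurable M"
      by (rule adapted \<Delta>; assumption)+
    have "distr M borel (S i) \<Otimes>\<^sub>M \<nu> = distr M (borel \<Otimes>\<^sub>M borel) (\<lambda>\<omega>. (S i \<omega>, \<Delta> i \<omega>))"
      using adapted(2)[of i] \<Delta>(2)[of i] by simp
    then show ?thesis
      by (simp add: distr_distr[OF that] comp_def)
  qed
  have "cdf (distr M borel (S (Suc i))) = F \<and> cdf (distr M borel (G i)) = generation_cdf \<alpha>c \<alpha>d Gmax Smax l"
    if F: "cdf (distr M borel (S i)) = F" for i
  proof
    have r: "real_distribution (distr M borel (S i))"
      by (rule M.real_distribution_distr) (rule adapted)
    have "distr M borel (S (Suc i)) = step_law (distr M borel (S i))"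
      unfolding step_law_def law[OF measurable_next_storage, symmetric]
      by (rule distr_cong) (simp_all add: rec)
    then show "cdf (distr M borel (S (Suc i))) = F"
      using cdf_step_law[OF r F] by simp
    have "G i \<omega> = generation (S i \<omega>) (\<Delta> i \<omega>)" if "\<omega> \<in> space M" for \<omega>
      unfolding assms(12)[OF that, of i, symmetric] by simp
    then have "distr M borel (G i)
        = distr (distr M borel (S i) \<Otimes>\<^sub>M \<nu>) borel (\<lambda>(s, \<delta>). generation s \<delta>)"
      unfolding law[OF borel_measurable_generation, symmetric]
      by (intro distr_cong) simp_all
    then show "cdf (distr M borel (G i)) = generation_cdf \<alpha>c \<alpha>d Gmax Smax l"
      using cdf_generation[OF r F] by simp
  qed
  then show ?thesis
    using stationary_interval_measure stationary_unique stationary_cdf by blast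
qed

end
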